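(* SCU is a theorem of NFU + Choice.
   Context: NFU is New Foundations with urelemente: the set theory with comprehension for stratifiable formulae, and extensionality weakened to sets (allowing urelemente); it is taken with a type-level ordered pair. Choice is the Axiom of Choice. A set $x$ is strongly cantorian if $\iota\restriction x=\{\langle y,\{y\}\rangle:y\in x\}$ is a set. SCU is the assertion: the sumset (union) of a strongly cantorian set of strongly cantorian sets is strongly cantorian. *)

theory Defs
  imports Main
begin

text \<open>
  First-order syntax with equality, in de Bruijn notation.  The non-logical symbols are membership,
  a sethood predicate (distinguishing the empty set from urelements) and a binary function symbol
  for the ordered pair.
\<close>

datatype tm = Var nat | OPair tm tm

datatype fm =
    Bot
  | Eq tm tm  (infix "\<^bold>=" 55)
  | Mem tm tm  (infix "\<^bold>\<in>" 55)
  | IsSet tm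
  | Imp fm fm  (infixr "\<^bold>\<longrightarrow>" 42)
  | All fm

definition Neg :: "fm \<Rightarrow> fm"  ("\<^bold>\<not> _" [54] 54)
  where "\<^bold>\<not> A = (A \<^bold>\<longrightarrow> Bot)"

definition Conj :: "fm \<Rightarrow> fm \<Rightarrow> fm"  (infixr "\<^bold>\<and>" 46)
  where "(A \<^bold>\<and> B) = \<^bold>\<not> (A \<^bold>\<longrightarrow> \<^bold>\<not> B)"

definition Iff :: "fm \<Rightarrow> fm \<Rightarrow> fm"  (infix "\<^bold>\<longleftrightarrow>" 41)
  where "(A \<^bold>\<longleftrightarrow> B) = ((A \<^bold>\<longrightarrow> B) \<^bold>\<and> (B \<^bold>\<longrightarrow> A))"

definition Ex :: "fm \<Rightarrow> fm"
  where "Ex A = \<^bold>\<not> All (\<^bold>\<not> A)"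

subsection \<open>Substitution and closed formulae\<close>

primrec tsub :: "(nat \<Rightarrow> tm) \<Rightarrow> tm \<Rightarrow> tm" where
  "tsub s (Var n) = s n"
| "tsub s (OPair t u) = OPair (tsub s t) (tsub s u)"

definition tlift :: "tm \<Rightarrow> tm"  ("\<up>_" [90] 90)
  where "\<up>t = tsub (\<lambda>n. Var (Suc n)) t"

definition up :: "(nat \<Rightarrow> tm) \<Rightarrow> nat \<Rightarrow> tm"
  where "up s = case_nat (Var 0) (\<lambda>n. \<up>(s n))"

primrec sub :: "(nat \<Rightarrow> tm) \<Rightarrow> fm \<Rightarrow> fm" where
  "sub s Bot = Bot"
| "sub s (t \<^bold>= u) = (tsub s t \<^bold>= tsub s u)"
| "sub s (t \<^bold>\<in> u) = (tsub s t \<^bold>\<in> tsub s u)"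
| "sub s (IsSet t) = IsSet (tsub s t)"
| "sub s (A \<^bold>\<longrightarrow> B) = (sub s A \<^bold>\<longrightarrow> sub s B)"
| "sub s (All A) = All (sub (up s) A)"

definition lift :: "fm \<Rightarrow> fm"
  where "lift A = sub (\<lambda>n. Var (Suc n)) A"

definition inst :: "fm \<Rightarrow> tm \<Rightarrow> fm"
  where "inst A t = sub (case_nat t Var) A"

primrec tm_below :: "nat \<Rightarrow> tm \<Rightarrow> bool" where
  "tm_below n (Var k) \<longleftrightarrow> k < n"
| "tm_below n (OPair t u) \<longleftrightarrow> tm_below n t \<and> tm_below n u"

primrec fm_below :: "nat \<Rightarrow> fm \<Rightarrow> bool" where
  "fm_below n Bot \<longleftrightarrow> True"
| "fm_below n (t \<^bold>= u) \<longleftrightarrow> tm_below n t \<and> tm_below n u"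
| "fm_below n (t \<^bold>\<in> u) \<longleftrightarrow> tm_below n t \<and> tm_below n u"
| "fm_below n (IsSet t) \<longleftrightarrow> tm_below n t"
| "fm_below n (A \<^bold>\<longrightarrow> B) \<longleftrightarrow> fm_below n A \<and> fm_below n B"
| "fm_below n (All A) \<longleftrightarrow> fm_below (Suc n) A"

definition sentence :: "fm \<Rightarrow> bool"
  where "sentence A \<longleftrightarrow> fm_below 0 A"

subsection \<open>Natural deduction for classical first-order logic with equality\<close>

inductive derives :: "fm set \<Rightarrow> fm \<Rightarrow> bool"  (infix "\<turnstile>" 40) where
  Assm: "A \<in> T \<Longrightarrow> T \<turnstile> A"
| ImpI: "insert A T \<turnstile> B \<Longrightarrow> T \<turnstile> (A \<^bold>\<longrightarrow> B)"
| ImpE: "T \<turnstile> (A \<^bold>\<longrightarrow> B) \<Longrightarrow> T \<turnstile> A \<Longrightarrow> T \<turnstile> B"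
| Contr: "insert (\<^bold>\<not> A) T \<turnstile> Bot \<Longrightarrow> T \<turnstile> A"
| AllI: "lift ` T \<turnstile> A \<Longrightarrow> T \<turnstile> All A"
| AllE: "T \<turnstile> All A \<Longrightarrow> T \<turnstile> inst A t"
| EqRefl: "T \<turnstile> (t \<^bold>= t)"
| EqSubst: "T \<turnstile> (t \<^bold>= u) \<Longrightarrow> T \<turnstile> inst A t \<Longrightarrow> T \<turnstile> inst A u"

subsection \<open>Stratification\<close>

text \<open>
  A type assignment \<open>e\<close> assigns a type to every free variable; a bound variable receives its type at
  its quantifier.  That the pair is type-level means that a pair and its two components all have
  the same type.
\<close>

primrec has_type :: "(nat \<Rightarrow> nat) \<Rightarrow> tm \<Rightarrow> nat \<Rightarrow> bool" where
  "has_type e (Var k) i \<longleftrightarrow> e k = i"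
| "has_type e (OPair t u) i \<longleftrightarrow> has_type e t i \<and> has_type e u i"

primrec stratified_by :: "(nat \<Rightarrow> nat) \<Rightarrow> fm \<Rightarrow> bool" where
  "stratified_by e Bot \<longleftrightarrow> True"
| "stratified_by e (t \<^bold>= u) \<longleftrightarrow> (\<exists>i. has_type e t i \<and> has_type e u i)"
| "stratified_by e (t \<^bold>\<in> u) \<longleftrightarrow> (\<exists>i. has_type e t i \<and> has_type e u (Suc i))"
| "stratified_by e (IsSet t) \<longleftrightarrow> (\<exists>i. has_type e t i)"
| "stratified_by e (A \<^bold>\<longrightarrow> B) \<longleftrightarrow> stratified_by e A \<and> stratified_by e B"
| "stratified_by e (All A) \<longleftrightarrow> (\<exists>i. stratified_by (case_nat i e) A)"

definition stratified :: "fm \<Rightarrow> bool"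
  where "stratified A \<longleftrightarrow> (\<exists>e. stratified_by e A)"

subsection \<open>The axioms of NFU\<close>

text \<open>Only sets have members.\<close>
definition Sethood :: fm
  where "Sethood = All (All (Var 0 \<^bold>\<in> Var 1 \<^bold>\<longrightarrow> IsSet (Var 1)))"

definition Extensionality :: fm
  where "Extensionality = All (All
    (IsSet (Var 0) \<^bold>\<and> IsSet (Var 1) \<^bold>\<and> All (Var 0 \<^bold>\<in> Var 1 \<^bold>\<longleftrightarrow> Var 0 \<^bold>\<in> Var 2)
      \<^bold>\<longrightarrow> Var 0 \<^bold>= Var 1))"

definition Pairing :: fm
  where "Pairing = All (All (All (All
    (OPair (Var 0) (Var 1) \<^bold>= OPair (Var 2) (Var 3)
      \<^bold>\<longrightarrow> Var 0 \<^bold>= Var 2 \<^bold>\<and> Var 1 \<^bold>= Var 3))))"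

text \<open>
  In \<open>A\<close>, variable \<open>0\<close> is the element and the other free variables are parameters.  The substitution
  shifts the parameters past the quantifier of the comprehended set, which therefore does not
  occur in the defining condition.
\<close>
definition Comprehension :: "fm \<Rightarrow> fm"
  where "Comprehension A =
    Ex (IsSet (Var 0) \<^bold>\<and> All (Var 0 \<^bold>\<in> Var 1 \<^bold>\<longleftrightarrow> sub (up (\<lambda>n. Var (Suc n))) A))"

definition NFU :: "fm set"
  where "NFU = {Sethood, Extensionality, Pairing} \<union>
    {(All ^^ n) (Comprehension A) | n A.
      stratified A \<and> sentence ((All ^^ n) (Comprehension A))}"

text \<open>Every set of pairwise disjoint nonempty sets has a choice set.\<close>
definition Choice :: fm
  where "Choice = All
    (IsSet (Var 0)
     \<^bold>\<and> All (Var 0 \<^bold>\<in> Var 1 \<^bold>\<longrightarrow> Ex (Var 0 \<^bold>\<in> Var 1))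
     \<^bold>\<and> All (All (Var 0 \<^bold>\<in> Var 2 \<^bold>\<and> Var 1 \<^bold>\<in> Var 2 \<^bold>\<and> Ex (Var 0 \<^bold>\<in> Var 1 \<^bold>\<and> Var 0 \<^bold>\<in> Var 2)
                \<^bold>\<longrightarrow> Var 0 \<^bold>= Var 1))
     \<^bold>\<longrightarrow> Ex (IsSet (Var 0)
          \<^bold>\<and> All (Var 0 \<^bold>\<in> Var 2
                 \<^bold>\<longrightarrow> Ex (All ((Var 0 \<^bold>\<in> Var 2 \<^bold>\<and> Var 0 \<^bold>\<in> Var 3) \<^bold>\<longleftrightarrow> Var 0 \<^bold>= Var 1)))))"

subsection \<open>Strongly cantorian sets and SCU\<close>

definition is_singleton :: "tm \<Rightarrow> tm \<Rightarrow> fm"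
  where "is_singleton z y = (IsSet z \<^bold>\<and> All (Var 0 \<^bold>\<in> \<up>z \<^bold>\<longleftrightarrow> Var 0 \<^bold>= \<up>y))"

text \<open>\<open>f\<close> is the singleton map restricted to \<open>x\<close>, that is, the set of all \<open>\<langle>y,{y}\<rangle>\<close> with \<open>y \<in> x\<close>.\<close>
definition is_iota_restr :: "tm \<Rightarrow> tm \<Rightarrow> fm"
  where "is_iota_restr f x = (IsSet f \<^bold>\<and>
    All (Var 0 \<^bold>\<in> \<up>f \<^bold>\<longleftrightarrow>
      Ex (Var 0 \<^bold>\<in> \<up>(\<up>x) \<^bold>\<and>
        Ex (is_singleton (Var 0) (Var 1) \<^bold>\<and> Var 2 \<^bold>= OPair (Var 1) (Var 0)))))"

definition strongly_cantorian :: "tm \<Rightarrow> fm"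
  where "strongly_cantorian x = (IsSet x \<^bold>\<and> Ex (is_iota_restr (Var 0) (\<up>x)))"

definition is_sumset :: "tm \<Rightarrow> tm \<Rightarrow> fm"
  where "is_sumset u x = (IsSet u \<^bold>\<and>
    All (Var 0 \<^bold>\<in> \<up>u \<^bold>\<longleftrightarrow> Ex (Var 0 \<^bold>\<in> \<up>(\<up>x) \<^bold>\<and> Var 1 \<^bold>\<in> Var 0)))"

definition SCU :: fm
  where "SCU = All
    (strongly_cantorian (Var 0) \<^bold>\<and> All (Var 0 \<^bold>\<in> Var 1 \<^bold>\<longrightarrow> strongly_cantorian (Var 0))
      \<^bold>\<longrightarrow> Ex (is_sumset (Var 0) (Var 1) \<^bold>\<and> strongly_cantorian (Var 0)))"

end

theory Submission
  imports Defs "HOL-Library.Countable_Set"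
begin

text \<open>
  A completeness theorem for the calculus reduces the claim to one about models of NFU with Choice.

  Inside such a model, let \<open>X\<close> be a strongly cantorian set of strongly cantorian sets.  The union of
  the maps \<open>\<iota>\<restriction>x\<close> for \<open>x \<in> X\<close> would be the map that is wanted, but the condition \<open>f = \<iota>\<restriction>x\<close> is not
  stratified: it relates \<open>y\<close> to \<open>{y}\<close> at one and the same type.  Two ideas give a stratified
  substitute for it.

  First, Choice makes each \<open>\<iota>\<restriction>x\<close> recognisable by its structure.  Fix a function \<open>c\<close> that chooses an
  element of every nonempty set, and call a bijection \<open>f\<close> from \<open>x\<close> to the set of singletons of elements
  of \<open>x\<close> a choice isomorphism if it carries the choice from \<open>s \<subseteq> x\<close> to the singleton of the choice
  from \<open>\<Union>f``s\<close>.  Then \<open>\<iota>\<restriction>x\<close> is one, and there is no other: \<open>f\<close> permutes, up to singletons,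
  the set \<open>B\<close> of those \<open>y\<close> with \<open>f(y) \<noteq> {y}\<close>, so if \<open>B\<close> were nonempty then \<open>f\<close> would send its
  chosen element \<open>b\<close> to \<open>{b}\<close> (\<open>choice_iso_iota\<close>, \<open>choice_iso_unique\<close>).

  Secondly, the occurrences of \<open>x\<close> on the two sides of \<open>f\<close> may carry different types.  Being
  a choice isomorphism from \<open>x\<close> to the singletons of elements of \<open>x'\<close> is stratified if the type of
  \<open>x'\<close> is one below that of \<open>x\<close>, and \<open>c\<close> may enter twice, as two parameters.  The equation \<open>x = x'\<close>
  is then expressed by \<open>\<langle>x,{x'}\<rangle> \<in> \<iota>\<restriction>X\<close>, which is where the hypothesis on \<open>X\<close> is used.  Hence the pairs
  that belong to some such \<open>f\<close> form a set, and this set is \<open>\<iota>\<restriction>\<Union>X\<close> (\<open>iota_union_ex\<close>).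
\<close>

section \<open>Substitution\<close>

lemma tsub_tsub: "tsub s (tsub r t) = tsub (\<lambda>n. tsub s (r n)) t"
  by (induction t) auto

lemma tsub_Var [simp]: "tsub Var t = t"
  by (induction t) auto

lemma tsub_up_tlift: "tsub (up s) (\<up>t) = \<up>(tsub s t)"
  by (simp add: tlift_def tsub_tsub up_def)

lemma tsub_case_tlift [simp]: "tsub (case_nat u s) (\<up>t) = tsub s t"
  by (simp add: tlift_def tsub_tsub)

lemma up_simps [simp]: "up s 0 = Var 0" "up s (Suc n) = \<up>(s n)"
  by (simp_all add: up_def)

lemma up_Var [simp]: "up Var = Var"
  by (rule ext) (simp add: up_def tlift_def split: nat.split)

lemma sub_Var [simp]: "sub Var A = A"
  by (induction A) auto

lemma tsub_up: "(\<lambda>n. tsub (up s) (up r n)) = up (\<lambda>n. tsub s (r n))"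
  by (rule ext) (simp add: up_def [of r] up_def [of "\<lambda>n. tsub s (r n)"] tsub_up_tlift split: nat.split)

lemma sub_sub: "sub s (sub r A) = sub (\<lambda>n. tsub s (r n)) A"
  by (induction A arbitrary: s r) (auto simp: tsub_tsub tsub_up)

lemma inst_sub_up: "inst (sub (up s) A) t = sub (case_nat t s) A"
proof -
  have "(\<lambda>n. tsub (case_nat t Var) (up s n)) = case_nat t s"
    by (rule ext) (simp add: up_def split: nat.split)
  then show ?thesis by (simp add: inst_def sub_sub)
qed

lemma sub_inst: "sub s (inst A t) = inst (sub (up s) A) (tsub s t)"
proof -
  have "(\<lambda>n. tsub s (case n of 0 \<Rightarrow> t | Suc x \<Rightarrow> Var x)) = case_nat (tsub s t) s"
    by (rule ext) (simp split: nat.split)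
  then show ?thesis by (simp add: inst_sub_up) (simp add: inst_def sub_sub)
qed

lemma sub_up_lift: "sub (up s) (lift A) = lift (sub s A)"
  by (simp add: lift_def sub_sub tlift_def)

lemma tsub_cong_below: "tm_below n t \<Longrightarrow> (\<And>k. k < n \<Longrightarrow> s k = r k) \<Longrightarrow> tsub s t = tsub r t"
  by (induction t) auto

lemma sub_cong_below: "fm_below n A \<Longrightarrow> (\<And>k. k < n \<Longrightarrow> s k = r k) \<Longrightarrow> sub s A = sub r A"
proof (induction A arbitrary: n s r)
  case (All A)
  have "sub (up s) A = sub (up r) A"
    by (rule All.IH[of "Suc n"]) (use All.prems in \<open>auto simp: up_def split: nat.split\<close>)
  then show ?case by simp
next
  case (Imp A B)
  then show ?case
    using Imp.IH(1)[of n s r] Imp.IH(2)[of n s r] by simp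
qed (simp; metis tsub_cong_below)+

lemma sub_sentence: "sentence A \<Longrightarrow> sub s A = A"
  using sub_cong_below[of 0 A s Var] by (simp add: sentence_def)

lemma tm_below_mono: "tm_below m t \<Longrightarrow> m \<le> n \<Longrightarrow> tm_below n t"
  by (induction t) auto

lemma fm_below_mono: "fm_below m A \<Longrightarrow> m \<le> n \<Longrightarrow> fm_below n A"
  by (induction A arbitrary: m n) (auto intro: tm_below_mono)

lemma tm_below_ex: "\<exists>n. tm_below n t"
proof (induction t)
  case (OPair t u)
  then obtain m n where "tm_below m t" "tm_below n u" by blast
  then have "tm_below (max m n) (OPair t u)" by (auto intro: tm_below_mono)
  then show ?case by blast
qed auto

lemma fm_below_ex: "\<exists>n. fm_below n A"
proof (induction A)
  case (Eq t u)
  obtain m n where "tm_below m t" "tm_below n u" using tm_below_ex by blast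
  then have "fm_below (max m n) (t \<^bold>= u)" by (auto intro: tm_below_mono)
  then show ?case by blast
next
  case (Mem t u)
  obtain m n where "tm_below m t" "tm_below n u" using tm_below_ex by blast
  then have "fm_below (max m n) (t \<^bold>\<in> u)" by (auto intro: tm_below_mono)
  then show ?case by blast
next
  case (Imp A B)
  then obtain m n where "fm_below m A" "fm_below n B" by blast
  then have "fm_below (max m n) (A \<^bold>\<longrightarrow> B)" by (auto intro: fm_below_mono)
  then show ?case by blast
next
  case (All A)
  then obtain m where "fm_below m A" by blast
  then have "fm_below m (All A)" by (auto intro: fm_below_mono)
  then show ?case by blast
qed (use tm_below_ex in auto)

lemma fm_below_ex_finite: "finite F \<Longrightarrow> \<exists>n. \<forall>A\<in>F. fm_below n A"
proof (induction rule: finite_induct)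
  case (insert A F)
  then obtain m n where "\<forall>A\<in>F. fm_below m A" "fm_below n A" using fm_below_ex by blast
  then have "\<forall>A\<in>insert A F. fm_below (max m n) A" by (auto intro: fm_below_mono)
  then show ?case by blast
qed auto

lemma fm_below_All_pow: "fm_below k ((All ^^ n) A) \<longleftrightarrow> fm_below (k + n) A"
  by (induction n arbitrary: k) auto

section \<open>Derivations\<close>

lemma weakening: "T \<turnstile> A \<Longrightarrow> T \<subseteq> U \<Longrightarrow> U \<turnstile> A"
proof (induction arbitrary: U rule: derives.induct)
  case (ImpI A T B)
  then show ?case by (meson derives.ImpI insert_mono)
next
  case (Contr A T)
  then show ?case by (meson derives.Contr insert_mono)
next
  case (AllI T A)
  then show ?case by (meson derives.AllI image_mono)
qed (blast intro: derives.intros)+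

lemma derives_sub: "T \<turnstile> A \<Longrightarrow> sub s ` T \<turnstile> sub s A"
proof (induction arbitrary: s rule: derives.induct)
  case (Assm A T)
  then show ?case by (simp add: derives.Assm)
next
  case (ImpI A T B)
  then show ?case by (simp add: derives.ImpI)
next
  case (ImpE T A B)
  then show ?case using derives.ImpE[of "sub s ` T" "sub s A" "sub s B"] by simp
next
  case (Contr A T)
  then show ?case using derives.Contr[of "sub s A" "sub s ` T"] by (simp add: Neg_def)
next
  case (AllI T A)
  have "sub (up s) ` lift ` T = lift ` sub s ` T"
    by (simp add: sub_up_lift image_image)
  then show ?case using AllI.IH[of "up s"] by (simp add: derives.AllI)
next
  case (AllE T A t)
  then have "sub s ` T \<turnstile> All (sub (up s) A)" by simp
  then show ?case by (simp add: sub_inst derives.AllE)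
next
  case (EqRefl T t)
  then show ?case by (simp add: derives.EqRefl)
next
  case (EqSubst T t u A)
  then show ?case
    using derives.EqSubst[of "sub s ` T" "tsub s t" "tsub s u" "sub (up s) A"] by (simp add: sub_inst)
qed

lemma derives_finite: "T \<turnstile> A \<Longrightarrow> \<exists>F. finite F \<and> F \<subseteq> T \<and> F \<turnstile> A"
proof (induction rule: derives.induct)
  case (Assm A T)
  then show ?case by (intro exI[of _ "{A}"]) (simp add: derives.Assm)
next
  case (ImpI A T B)
  then obtain F where F: "finite F" "F \<subseteq> insert A T" "F \<turnstile> B" by blast
  then have "F - {A} \<turnstile> (A \<^bold>\<longrightarrow> B)" by (intro derives.ImpI[OF weakening[OF F(3)]]) blast
  then show ?case using F by (intro exI[of _ "F - {A}"]) blast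
next
  case (ImpE T A B)
  then obtain F G where F: "finite F" "F \<subseteq> T" "F \<turnstile> (A \<^bold>\<longrightarrow> B)" and G: "finite G" "G \<subseteq> T" "G \<turnstile> A"
    by blast
  have "F \<union> G \<turnstile> B" by (rule derives.ImpE[OF weakening[OF F(3)] weakening[OF G(3)]]) simp_all
  then show ?case using F G by (intro exI[of _ "F \<union> G"]) simp
next
  case (Contr A T)
  then obtain F where F: "finite F" "F \<subseteq> insert (\<^bold>\<not> A) T" "F \<turnstile> Bot" by blast
  then have "F - {\<^bold>\<not> A} \<turnstile> A" by (intro derives.Contr[OF weakening[OF F(3)]]) blast
  then show ?case using F by (intro exI[of _ "F - {\<^bold>\<not> A}"]) blast
next
  case (AllI T A)
  then obtain F where F: "finite F" "F \<subseteq> lift ` T" "F \<turnstile> A" by blast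
  then obtain G where "G \<subseteq> T" "finite G" "F = lift ` G" by (meson finite_subset_image)
  then show ?case using derives.AllI[of G A] F(3) by (intro exI[of _ G]) simp
next
  case (AllE T A t)
  then obtain F where "finite F" "F \<subseteq> T" "F \<turnstile> All A" by blast
  then show ?case using derives.AllE[of F A t] by (intro exI[of _ F]) simp
next
  case (EqRefl T t)
  then show ?case by (intro exI[of _ "{}"]) (simp add: derives.EqRefl)
next
  case (EqSubst T t u A)
  then obtain F G where F: "finite F" "F \<subseteq> T" "F \<turnstile> (t \<^bold>= u)"
    and G: "finite G" "G \<subseteq> T" "G \<turnstile> inst A t" by blast
  have "F \<union> G \<turnstile> inst A u"
    by (rule derives.EqSubst[OF weakening[OF F(3)] weakening[OF G(3)]]) simp_all
  then show ?case using F G by (intro exI[of _ "F \<union> G"]) simp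
qed

lemma NegE: "T \<turnstile> \<^bold>\<not> A \<Longrightarrow> T \<turnstile> A \<Longrightarrow> T \<turnstile> Bot"
  unfolding Neg_def by (rule ImpE)

text \<open>
  The eigenvariable rule in its named form.  A substitution that renames \<open>Var k\<close> to \<open>Var 0\<close> and shifts
  everything else turns the premise into a premise of \<open>AllI\<close>.
\<close>
lemma AllI_fresh:
  assumes "T \<turnstile> inst B (Var k)" "\<And>A. A \<in> T \<Longrightarrow> fm_below k A" "fm_below (Suc k) B"
  shows "T \<turnstile> All B"
proof -
  define s where "s m = (if m = k then Var 0 else Var (Suc m))" for m
  have "sub s A = lift A" if "A \<in> T" for A
    unfolding lift_def using assms(2)[OF that] by (rule sub_cong_below) (simp add: s_def)
  then have T: "sub s ` T = lift ` T" by auto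
  have "sub s (inst B (Var k)) = sub (case_nat (Var 0) s) B"
    by (simp add: sub_inst inst_sub_up s_def)
  also have "\<dots> = sub Var B"
    using assms(3) by (rule sub_cong_below) (auto simp: s_def split: nat.split)
  finally have "sub s (inst B (Var k)) = B" by simp
  then show ?thesis using derives_sub[OF assms(1), of s] by (simp add: T AllI)
qed

section \<open>Henkin sets\<close>

definition consistent :: "fm set \<Rightarrow> bool"
  where "consistent T \<longleftrightarrow> \<not> T \<turnstile> Bot"

lemma consistent_not_both: "consistent T \<Longrightarrow> A \<in> T \<Longrightarrow> \<^bold>\<not> A \<notin> T"
  unfolding consistent_def using NegE[OF Assm Assm, of A T] by blast

definition henkin :: "fm set \<Rightarrow> bool"
  where "henkin H \<longleftrightarrow> consistent H \<and> (\<forall>A. A \<in> H \<or> \<^bold>\<not> A \<in> H)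
    \<and> (\<forall>B. \<^bold>\<not> All B \<in> H \<longrightarrow> (\<exists>t. \<^bold>\<not> inst B t \<in> H))"

text \<open>
  One step of the Henkin construction.  As \<open>T\<close> consists of sentences and \<open>F\<close> is finite, some variable
  is fresh for both, and it serves as the witness.
\<close>
lemma consistent_step:
  assumes T: "\<And>A. A \<in> T \<Longrightarrow> sentence A" and "finite F" "consistent (T \<union> F)"
  shows "\<exists>F'. finite F' \<and> consistent (T \<union> F') \<and> F \<subseteq> F' \<and> (A \<in> F' \<or> \<^bold>\<not> A \<in> F')
    \<and> (\<forall>B. A = \<^bold>\<not> All B \<longrightarrow> A \<in> F' \<longrightarrow> (\<exists>t. \<^bold>\<not> inst B t \<in> F'))"
proof (cases "consistent (T \<union> insert A F)")
  case True
  show ?thesis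
  proof (cases "\<exists>B. A = \<^bold>\<not> All B")
    case False
    then show ?thesis using True assms(2) by (intro exI[of _ "insert A F"]) auto
  next
    case nAll: True
    then obtain B where A: "A = \<^bold>\<not> All B" by blast
    obtain k where k: "\<forall>C\<in>insert A F. fm_below k C"
      using fm_below_ex_finite[of "insert A F"] assms(2) by auto
    let ?F = "insert (\<^bold>\<not> inst B (Var k)) (insert A F)"
    have "consistent (T \<union> ?F)"
      unfolding consistent_def
    proof
      assume "T \<union> ?F \<turnstile> Bot"
      then have "T \<union> insert A F \<turnstile> inst B (Var k)" by (simp add: Contr)
      then have "T \<union> insert A F \<turnstile> All B"
      proof (rule AllI_fresh)
        show "fm_below k C" if "C \<in> T \<union> insert A F" for C
          using that k T by (auto simp: sentence_def intro: fm_below_mono[of 0])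
        show "fm_below (Suc k) B" using k by (simp add: A Neg_def)
      qed
      moreover have "T \<union> insert A F \<turnstile> \<^bold>\<not> All B" by (rule Assm) (simp add: A)
      ultimately show False using True NegE by (auto simp: consistent_def)
    qed
    then show ?thesis using assms(2) by (intro exI[of _ ?F]) (auto simp: A Neg_def)
  qed
next
  case False
  have "\<not> insert (\<^bold>\<not> A) (T \<union> F) \<turnstile> Bot"
  proof
    assume "insert (\<^bold>\<not> A) (T \<union> F) \<turnstile> Bot"
    then have 1: "T \<union> F \<turnstile> A" by (rule Contr)
    have "T \<union> F \<turnstile> \<^bold>\<not> A" using False by (simp add: consistent_def Neg_def ImpI)
    then show False using 1 assms(3) NegE by (auto simp: consistent_def)
  qed
  moreover have "A \<notin> F" using False assms(3) by (auto simp: insert_absorb)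
  moreover have "A \<noteq> \<^bold>\<not> A"
  proof -
    have "size A < size (\<^bold>\<not> A)" by (simp add: Neg_def)
    then show ?thesis by auto
  qed
  ultimately show ?thesis using assms(2)
    by (intro exI[of _ "insert (\<^bold>\<not> A) F"]) (auto simp: consistent_def)
qed

instance tm :: countable by countable_datatype
instance fm :: countable by countable_datatype

lemma henkin_extension:
  assumes T: "\<And>A. A \<in> T \<Longrightarrow> sentence A" and "consistent T"
  shows "\<exists>H. T \<subseteq> H \<and> henkin H"
proof -
  let ?P = "\<lambda>F. finite F \<and> consistent (T \<union> F)"
  let ?Q = "\<lambda>n F F'. F \<subseteq> F' \<and> (from_nat n \<in> F' \<or> \<^bold>\<not> from_nat n \<in> F')
    \<and> (\<forall>B. from_nat n = \<^bold>\<not> All B \<longrightarrow> from_nat n \<in> F' \<longrightarrow> (\<exists>t. \<^bold>\<not> inst B t \<in> F'))"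
  have "\<exists>G. \<forall>n. ?P (G n) \<and> ?Q n (G n) (G (Suc n))"
  proof (rule dependent_nat_choice)
    show "\<exists>F. ?P F" using assms(2) by (intro exI[of _ "{}"]) simp
    show "\<exists>F'. ?P F' \<and> ?Q n F F'" if "?P F" for F n
      using consistent_step[where T = T and F = F and A = "from_nat n", OF T] that by simp
  qed
  then obtain G where "\<forall>n. ?P (G n) \<and> ?Q n (G n) (G (Suc n))" by (elim exE)
  then have G: "?P (G n)" "?Q n (G n) (G (Suc n))" for n by simp_all
  have mono: "G m \<subseteq> G n" if "m \<le> n" for m n
    using lift_Suc_mono_le[of G m n] G(2) that by simp
  let ?H = "T \<union> (\<Union>n. G n)"
  have cons: "consistent ?H"
    unfolding consistent_def
  proof
    assume "?H \<turnstile> Bot"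
    then obtain F where F: "finite F" "F \<subseteq> ?H" "F \<turnstile> Bot" using derives_finite[of ?H Bot] by blast
    have "\<exists>n. F \<subseteq> T \<union> G n"
      using F(1,2)
    proof (induction rule: finite_induct)
      case (insert A F)
      then obtain m n where "F \<subseteq> T \<union> G m" "A \<in> T \<union> G n" by auto
      then have "insert A F \<subseteq> T \<union> G (max m n)" using mono[of m "max m n"] mono[of n "max m n"] by auto
      then show ?case by blast
    qed auto
    then obtain n where "F \<subseteq> T \<union> G n" by blast
    then have "T \<union> G n \<turnstile> Bot" by (rule weakening[OF F(3)])
    then show False using G(1)[of n] by (simp add: consistent_def)
  qed
  have compl: "A \<in> ?H \<or> \<^bold>\<not> A \<in> ?H" for A
    using G(2)[of "to_nat A"] unfolding from_nat_to_nat by blast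
  have wit: "\<exists>t. \<^bold>\<not> inst B t \<in> ?H" if "\<^bold>\<not> All B \<in> ?H" for B
  proof -
    let ?A = "\<^bold>\<not> All B"
    have "\<^bold>\<not> ?A \<notin> ?H" using consistent_not_both[OF cons that] by blast
    then show ?thesis using G(2)[of "to_nat ?A"] that unfolding from_nat_to_nat by blast
  qed
  have "henkin ?H" unfolding henkin_def using cons compl wit by blast
  then show ?thesis by blast
qed

context
  fixes H assumes H: "henkin H"
begin

lemma henkin_Neg: "\<^bold>\<not> A \<in> H \<longleftrightarrow> A \<notin> H"
  using H consistent_not_both[of H A] unfolding henkin_def by blast

lemma henkin_closed:
  assumes "H \<turnstile> A"
  shows "A \<in> H"
proof (rule ccontr)
  assume "A \<notin> H"
  then have "H \<turnstile> Bot" by (intro NegE[OF _ assms] Assm) (simp add: henkin_Neg)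
  then show False using H by (simp add: henkin_def consistent_def)
qed

lemma henkin_Bot: "Bot \<notin> H"
  using H Assm[of Bot H] unfolding henkin_def consistent_def by blast

lemma henkin_Imp: "(A \<^bold>\<longrightarrow> B) \<in> H \<longleftrightarrow> (A \<in> H \<longrightarrow> B \<in> H)"
proof
  assume "(A \<^bold>\<longrightarrow> B) \<in> H"
  then show "A \<in> H \<longrightarrow> B \<in> H"
    using henkin_closed[OF ImpE[OF Assm Assm], of A B] by blast
next
  assume *: "A \<in> H \<longrightarrow> B \<in> H"
  have "H \<turnstile> (A \<^bold>\<longrightarrow> B)"
  proof (cases "A \<in> H")
    case True
    then show ?thesis using * by (simp add: ImpI Assm)
  next
    case False
    then have "\<^bold>\<not> A \<in> H" by (simp add: henkin_Neg)
    then have "insert (\<^bold>\<not> B) (insert A H) \<turnstile> Bot" 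
      by (intro NegE[of _ A]) (simp_all add: Assm)
    then show ?thesis by (rule ImpI[OF Contr])
  qed
  then show "(A \<^bold>\<longrightarrow> B) \<in> H" by (rule henkin_closed)
qed

lemma henkin_All: "All B \<in> H \<longleftrightarrow> (\<forall>t. inst B t \<in> H)"
proof
  assume "All B \<in> H"
  then show "\<forall>t. inst B t \<in> H" using henkin_closed[OF AllE[OF Assm], of B] by blast
next
  assume *: "\<forall>t. inst B t \<in> H"
  then have "\<^bold>\<not> All B \<notin> H" using H henkin_Neg unfolding henkin_def by blast
  then show "All B \<in> H" by (simp add: henkin_Neg)
qed

lemma henkin_subst: "(t \<^bold>= u) \<in> H \<Longrightarrow> inst A t \<in> H \<Longrightarrow> inst A u \<in> H"
  using henkin_closed[OF EqSubst[OF Assm Assm], of t u A] by blast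

lemma henkin_refl: "(t \<^bold>= t) \<in> H"
  by (simp add: EqRefl henkin_closed)

lemma henkin_sym: "(t \<^bold>= u) \<in> H \<Longrightarrow> (u \<^bold>= t) \<in> H"
  using henkin_subst[of t u "Var 0 \<^bold>= \<up>t"] henkin_refl by (simp add: inst_def)

lemma henkin_trans: "(t \<^bold>= u) \<in> H \<Longrightarrow> (u \<^bold>= w) \<in> H \<Longrightarrow> (t \<^bold>= w) \<in> H"
  using henkin_subst[of u w "\<up>t \<^bold>= Var 0"] by (simp add: inst_def)

lemma henkin_Mem_cong:
  "(t \<^bold>= t') \<in> H \<Longrightarrow> (u \<^bold>= u') \<in> H \<Longrightarrow> (t \<^bold>\<in> u) \<in> H \<Longrightarrow> (t' \<^bold>\<in> u') \<in> H"
  using henkin_subst[of t t' "Var 0 \<^bold>\<in> \<up>u"] henkin_subst[of u u' "\<up>t' \<^bold>\<in> Var 0"]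
  by (simp add: inst_def)

lemma henkin_IsSet_cong: "(t \<^bold>= t') \<in> H \<Longrightarrow> IsSet t \<in> H \<Longrightarrow> IsSet t' \<in> H"
  using henkin_subst[of t t' "IsSet (Var 0)"] by (simp add: inst_def)

lemma henkin_OPair_cong:
  "(t \<^bold>= t') \<in> H \<Longrightarrow> (u \<^bold>= u') \<in> H \<Longrightarrow> (OPair t u \<^bold>= OPair t' u') \<in> H"
  using henkin_subst[of t t' "OPair (\<up>t) (\<up>u) \<^bold>= OPair (Var 0) (\<up>u)"]
    henkin_subst[of u u' "OPair (\<up>t) (\<up>u) \<^bold>= OPair (\<up>t') (Var 0)"] henkin_refl[of "OPair t u"]
  by (simp add: inst_def)

end

section \<open>Semantics and completeness\<close>

record 'a model =
  universe :: "'a set"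
  mem :: "'a \<Rightarrow> 'a \<Rightarrow> bool"
  isset :: "'a \<Rightarrow> bool"
  opair :: "'a \<Rightarrow> 'a \<Rightarrow> 'a"

primrec tval :: "'a model \<Rightarrow> (nat \<Rightarrow> 'a) \<Rightarrow> tm \<Rightarrow> 'a" where
  "tval M v (Var n) = v n"
| "tval M v (OPair t u) = opair M (tval M v t) (tval M v u)"

primrec sat :: "'a model \<Rightarrow> (nat \<Rightarrow> 'a) \<Rightarrow> fm \<Rightarrow> bool" where
  "sat M v Bot \<longleftrightarrow> False"
| "sat M v (t \<^bold>= u) \<longleftrightarrow> tval M v t = tval M v u"
| "sat M v (t \<^bold>\<in> u) \<longleftrightarrow> mem M (tval M v t) (tval M v u)"
| "sat M v (IsSet t) \<longleftrightarrow> isset M (tval M v t)"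
| "sat M v (A \<^bold>\<longrightarrow> B) \<longleftrightarrow> (sat M v A \<longrightarrow> sat M v B)"
| "sat M v (All A) \<longleftrightarrow> (\<forall>d\<in>universe M. sat M (case_nat d v) A)"

lemma sat_connectives [simp]:
  "sat M v (\<^bold>\<not> A) \<longleftrightarrow> \<not> sat M v A"
  "sat M v (A \<^bold>\<and> B) \<longleftrightarrow> sat M v A \<and> sat M v B"
  "sat M v (A \<^bold>\<longleftrightarrow> B) \<longleftrightarrow> (sat M v A \<longleftrightarrow> sat M v B)"
  "sat M v (Ex A) \<longleftrightarrow> (\<exists>d\<in>universe M. sat M (case_nat d v) A)"
  by (auto simp: Neg_def Conj_def Iff_def Ex_def)

lemma tval_tsub: "tval M v (tsub s t) = tval M (\<lambda>n. tval M v (s n)) t"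
  by (induction t) auto

lemma tval_tlift [simp]: "tval M (case_nat d v) (\<up>t) = tval M v t"
  by (simp add: tlift_def tval_tsub)

lemma sat_sub: "sat M v (sub s A) \<longleftrightarrow> sat M (\<lambda>n. tval M v (s n)) A"
proof (induction A arbitrary: v s)
  case (All A)
  have "(\<lambda>n. tval M (case_nat d v) (up s n)) = case_nat d (\<lambda>n. tval M v (s n))" for d
    by (rule ext) (simp add: up_def split: nat.split)
  then show ?case by (simp add: All.IH)
qed (simp_all add: tval_tsub)

text \<open>
  The model of terms modulo provable equality.  The map \<open>h\<close> is meant to identify exactly the provably
  equal terms; leaving it arbitrary allows any set of the right cardinality as the universe.
\<close>
definition term_model :: "(tm \<Rightarrow> 'a) \<Rightarrow> fm set \<Rightarrow> 'a model"
  where "term_model h H =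
    \<lparr> universe = range h,
      mem = (\<lambda>a b. (inv h a \<^bold>\<in> inv h b) \<in> H),
      isset = (\<lambda>a. IsSet (inv h a) \<in> H),
      opair = (\<lambda>a b. h (OPair (inv h a) (inv h b))) \<rparr>"

text \<open>
  The valuation assigns classes of terms to variables, so its effect is that of a substitution, and
  the quantifier case is the Henkin property.
\<close>
lemma term_model_sat:
  assumes H: "henkin H" and h: "\<And>t u. h t = h u \<longleftrightarrow> (t \<^bold>= u) \<in> H"
  shows "sat (term_model h H) (\<lambda>n. h (s n)) A \<longleftrightarrow> sub s A \<in> H"
proof -
  let ?M = "term_model h H"
  have inv: "(inv h (h t) \<^bold>= t) \<in> H" for t
    by (metis h f_inv_into_f rangeI)
  have inv': "(t \<^bold>= inv h (h t)) \<in> H" for t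
    using inv henkin_sym[OF H] by blast
  have tval: "tval ?M (\<lambda>n. h (s n)) t = h (tsub s t)" for s t
    by (induction t) (auto simp: term_model_def h intro!: henkin_OPair_cong[OF H] inv)
  show ?thesis
  proof (induction A arbitrary: s)
    case Bot
    then show ?case using henkin_Bot[OF H] by simp
  next
    case (Eq t u)
    then show ?case by (simp add: tval h)
  next
    case (Mem t u)
    then show ?case
      using henkin_Mem_cong[OF H] inv inv' by (simp add: tval) (simp add: term_model_def, blast)
  next
    case (IsSet t)
    then show ?case
      using henkin_IsSet_cong[OF H] inv inv' by (simp add: tval) (simp add: term_model_def, blast)
  next
    case (Imp A B)
    then show ?case by (simp add: henkin_Imp[OF H])
  next
    case (All A)
    have "case_nat (h t) (\<lambda>n. h (s n)) = (\<lambda>n. h (case_nat t s n))" for t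
      by (rule ext) (simp split: nat.split)
    then have "sat ?M (\<lambda>n. h (s n)) (All A) \<longleftrightarrow> (\<forall>t. sub (case_nat t s) A \<in> H)"
      using All.IH by (simp add: term_model_def)
    then show ?case by (simp add: henkin_All[OF H] inst_sub_up)
  qed
qed

definition models :: "'a model \<Rightarrow> fm set \<Rightarrow> bool"
  where "models M T \<longleftrightarrow> (\<forall>a\<in>universe M. \<forall>b\<in>universe M. opair M a b \<in> universe M)
    \<and> universe M \<noteq> {} \<and> (\<forall>A\<in>T. \<forall>v. range v \<subseteq> universe M \<longrightarrow> sat M v A)"

lemma models_axiom:
  assumes "models M T" "A \<in> T" "range v \<subseteq> universe M"
  shows "sat M v A"
  using assms by (auto simp: models_def)

lemma term_model_models:
  assumes H: "henkin H" and h: "\<And>t u. h t = h u \<longleftrightarrow> (t \<^bold>= u) \<in> H"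
    and T: "T \<subseteq> H" "\<And>A. A \<in> T \<Longrightarrow> sentence A"
  shows "models (term_model h H) T"
proof -
  have "sat (term_model h H) v A" if A: "A \<in> T" and "range v \<subseteq> range h" for A v
  proof -
    have "v = (\<lambda>n. h (inv h (v n)))"
    proof
      show "v n = h (inv h (v n))" for n
        using that(2) by (intro f_inv_into_f[symmetric]) auto
    qed
    then show ?thesis
      using term_model_sat[OF H h, of "\<lambda>n. inv h (v n)" A] A T by (simp add: sub_sentence subsetD)
  qed
  then show ?thesis by (auto simp: models_def term_model_def)
qed

text \<open>
  Completeness with respect to models whose universe is a full type.  A term model lives on a
  countable set of equivalence classes; when this set is infinite, it can be relabelled by all of
  the natural numbers, so that quantifiers need no relativisation in later arguments.
\<close>
lemma completeness:
  assumes T: "\<And>A. A \<in> T \<Longrightarrow> sentence A" and A: "sentence A"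
    and inf: "\<And>M :: tm set model. models M T \<Longrightarrow> infinite (universe M)"
    and valid: "\<And>M :: nat model. models M T \<Longrightarrow> universe M = UNIV \<Longrightarrow> models M {A}"
  shows "T \<turnstile> A"
proof (rule ccontr)
  assume "\<not> T \<turnstile> A"
  then have "consistent (insert (\<^bold>\<not> A) T)"
    unfolding consistent_def using Contr by blast
  moreover have sent: "sentence B" if "B \<in> insert (\<^bold>\<not> A) T" for B
    using that T A by (auto simp: sentence_def Neg_def)
  ultimately obtain H where H: "henkin H" "insert (\<^bold>\<not> A) T \<subseteq> H"
    using henkin_extension by blast
  define h where "h t = {u. (t \<^bold>= u) \<in> H}" for t
  have h: "h t = h u \<longleftrightarrow> (t \<^bold>= u) \<in> H" for t u
    using henkin_refl[OF H(1)] henkin_sym[OF H(1)] henkin_trans[OF H(1)] unfolding h_def by blast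
  have "infinite (range h)"
    using inf[OF term_model_models[OF H(1) h, of T]] H(2) T by (simp add: term_model_def)
  then have bij: "bij_betw (to_nat_on (range h)) (range h) UNIV"
    by (intro to_nat_on_infinite) auto
  \<comment> \<open>the same model, relabelled so that its universe is the whole type\<close>
  define g where "g t = to_nat_on (range h) (h t)" for t
  have g: "g t = g u \<longleftrightarrow> (t \<^bold>= u) \<in> H" for t u
    unfolding g_def h[symmetric] using bij by (auto simp: bij_betw_def inj_on_def)
  have "range g = UNIV"
    using bij by (simp add: bij_betw_def g_def image_image)
  then have "models (term_model g H) {A}"
    using valid[OF term_model_models[OF H(1) g, of T]] H(2) T by (simp add: term_model_def)
  then have "sat (term_model g H) (\<lambda>n. g (Var n)) A"
    by (rule models_axiom) (auto simp: term_model_def)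
  moreover have "sat (term_model g H) (\<lambda>n. g (Var n)) (\<^bold>\<not> A)"
    using term_model_sat[OF H(1) g, of Var "\<^bold>\<not> A"] H(2) by simp
  ultimately show False by simp
qed

section \<open>Models of NFU\<close>

lemma has_type_tlift [simp]: "has_type (case_nat j e) (\<up>t) i \<longleftrightarrow> has_type e t i"
  by (induction t) (auto simp: tlift_def)

lemma stratified_by_connectives [simp]:
  "stratified_by e (\<^bold>\<not> A) \<longleftrightarrow> stratified_by e A"
  "stratified_by e (A \<^bold>\<and> B) \<longleftrightarrow> stratified_by e A \<and> stratified_by e B"
  "stratified_by e (A \<^bold>\<longleftrightarrow> B) \<longleftrightarrow> stratified_by e A \<and> stratified_by e B"
  "stratified_by e (Ex A) \<longleftrightarrow> (\<exists>i. stratified_by (case_nat i e) A)"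
  by (auto simp: Neg_def Conj_def Iff_def Ex_def)

lemma range_case_nat: "range (case_nat d v) = insert d (range v)"
  by (auto simp: image_iff split: nat.split) (metis nat.case not0_implies_Suc)+

text \<open>
  Truth under every valuation is insensitive to universal closure, so the sentences
  in the comprehension scheme can be replaced by the open formulae that they close.
\<close>
lemma sat_All_pow:
  "(\<forall>v. range v \<subseteq> universe M \<longrightarrow> sat M v ((All ^^ n) A))
    \<longleftrightarrow> (\<forall>v. range v \<subseteq> universe M \<longrightarrow> sat M v A)"
proof (induction n)
  case (Suc n)
  have "(\<forall>v. range v \<subseteq> universe M \<longrightarrow> sat M v (All B))
    \<longleftrightarrow> (\<forall>v. range v \<subseteq> universe M \<longrightarrow> sat M v B)" for B
  proof safe
    fix v :: "nat \<Rightarrow> 'a"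
    assume *: "\<forall>v. range v \<subseteq> universe M \<longrightarrow> sat M v (All B)" and v: "range v \<subseteq> universe M"
    have "v = case_nat (v 0) (\<lambda>n. v (Suc n))"
      by (rule ext) (simp split: nat.split)
    moreover have "sat M (case_nat (v 0) (\<lambda>n. v (Suc n))) B"
      using *[rule_format, of "\<lambda>n. v (Suc n)"] v by auto
    ultimately show "sat M v B" by simp
  qed (auto simp: range_case_nat)
  then show ?case by (simp add: Suc.IH)
qed simp

lemma models_comprehension:
  assumes M: "models M NFU" and "stratified_by e A" and v: "range v \<subseteq> universe M"
  shows "\<exists>x\<in>universe M. isset M x \<and> (\<forall>y\<in>universe M. mem M y x \<longleftrightarrow> sat M (case_nat y v) A)"
proof -
  obtain n where "fm_below n (Comprehension A)" using fm_below_ex by blast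
  then have "(All ^^ n) (Comprehension A) \<in> NFU"
    using assms(2) by (auto simp: NFU_def stratified_def sentence_def fm_below_All_pow)
  then have "sat M v (Comprehension A)"
    using M v sat_All_pow[of M n "Comprehension A"] by (auto simp: models_def)
  moreover have "(\<lambda>n. tval M (case_nat y (case_nat x v)) (up (\<lambda>n. Var (Suc n)) n)) = case_nat y v" for x y
    by (rule ext) (simp add: up_def tlift_def split: nat.split)
  ultimately show ?thesis by (simp add: Comprehension_def sat_sub)
qed

lemma Sethood_in_NFU: "Sethood \<in> NFU"
  and Extensionality_in_NFU: "Extensionality \<in> NFU"
  and Pairing_in_NFU: "Pairing \<in> NFU"
  by (simp_all add: NFU_def)

lemma infinite_if_pairing_function:
  assumes p: "\<And>a b. a \<in> D \<Longrightarrow> b \<in> D \<Longrightarrow> p a b \<in> D"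
    and inj: "\<And>a b c d. \<lbrakk>a \<in> D; b \<in> D; c \<in> D; d \<in> D; p a b = p c d\<rbrakk> \<Longrightarrow> a = c \<and> b = d"
    and ab: "a \<in> D" "b \<in> D" "a \<noteq> b"
  shows "infinite D"
proof
  assume D: "finite D"
  have "inj_on (\<lambda>(a, b). p a b) (D \<times> D)"
  proof (rule inj_onI, clarify)
    show "a = c \<and> b = d" if "a \<in> D" "b \<in> D" "c \<in> D" "d \<in> D" "p a b = p c d" for a b c d
      using inj that .
  qed
  moreover have "(\<lambda>(a, b). p a b) ` (D \<times> D) \<subseteq> D"
    using p by auto
  ultimately have "card (D \<times> D) \<le> card D" using D by (rule card_inj_on_le)
  moreover have "card {a, b} \<le> card D" using D ab by (intro card_mono) auto
  ultimately show False using ab by (simp add: card_cartesian_product)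
qed

text \<open>
  The empty and the universal set differ, and pairing embeds the square of the universe in
  the universe.
\<close>
lemma models_NFU_infinite:
  assumes M: "models M NFU"
  shows "infinite (universe M)"
proof -
  obtain d where d: "d \<in> universe M" using M by (auto simp: models_def)
  then have v: "range (\<lambda>_::nat. d) \<subseteq> universe M" by auto
  obtain x where x: "x \<in> universe M" "\<forall>z\<in>universe M. \<not> mem M z x"
    using models_comprehension[OF M _ v, of "\<lambda>_. 0" Bot] by auto
  obtain y where y: "y \<in> universe M" "\<forall>z\<in>universe M. mem M z y"
    using models_comprehension[OF M _ v, of "\<lambda>_. 0" "Bot \<^bold>\<longrightarrow> Bot"] by auto
  have xy: "x \<noteq> y" using x y by blast
  have "sat M (\<lambda>_. d) Pairing"
    using models_axiom[OF M Pairing_in_NFU v] .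
  then have P: "\<lbrakk>a \<in> universe M; b \<in> universe M; c \<in> universe M; e \<in> universe M;
      opair M a b = opair M c e\<rbrakk> \<Longrightarrow> a = c \<and> b = e" for a b c e
    by (simp add: Pairing_def)
  have closed: "opair M a b \<in> universe M" if "a \<in> universe M" "b \<in> universe M" for a b
    using M that by (simp add: models_def)
  show ?thesis
    using infinite_if_pairing_function[of "universe M" "opair M", OF closed P x(1) y(1) xy] .
qed

text \<open>
  The formula \<open>\<langle>y,{z}\<rangle> \<in> f\<close>.  The pair is type-level, so \<open>y\<close> lies one type above \<open>z\<close>.
\<close>
definition sing_pair_in :: "tm \<Rightarrow> tm \<Rightarrow> tm \<Rightarrow> fm"
  where "sing_pair_in y z f = Ex (is_singleton (Var 0) (\<up>z) \<^bold>\<and> OPair (\<up>y) (Var 0) \<^bold>\<in> \<up>f)"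

lemma stratified_by_is_singleton:
  "stratified_by e (is_singleton a b) \<longleftrightarrow> (\<exists>i. has_type e a (Suc i) \<and> has_type e b i)"
  by (auto simp: is_singleton_def)

lemma stratified_by_sing_pair_in:
  "stratified_by e (sing_pair_in y z f)
    \<longleftrightarrow> (\<exists>i. has_type e z i \<and> has_type e y (Suc i) \<and> has_type e f (Suc (Suc i)))"
  by (auto simp: sing_pair_in_def stratified_by_is_singleton)

text \<open>
  The formula for \<open>choice_iso\<close>, with the free variables \<open>f = 0\<close>, \<open>x' = 1\<close>, \<open>x = 2\<close>, \<open>c = 5\<close> and
  \<open>d = 6\<close>; the indices 3 and 4 are left to the context in \<open>iota_union_ex\<close>.
\<close>
definition Choice_iso :: fm
  where "Choice_iso = (
    All (All (sing_pair_in (Var 1) (Var 0) (Var 2) \<^bold>\<longrightarrow> Var 1 \<^bold>\<in> Var 4 \<^bold>\<and> Var 0 \<^bold>\<in> Var 3))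
    \<^bold>\<and> All (All (All (sing_pair_in (Var 2) (Var 1) (Var 3) \<^bold>\<and> sing_pair_in (Var 2) (Var 0) (Var 3)
        \<^bold>\<longrightarrow> Var 1 \<^bold>= Var 0)))
    \<^bold>\<and> All (All (All (sing_pair_in (Var 2) (Var 0) (Var 3) \<^bold>\<and> sing_pair_in (Var 1) (Var 0) (Var 3)
        \<^bold>\<longrightarrow> Var 2 \<^bold>= Var 1)))
    \<^bold>\<and> All (Var 0 \<^bold>\<in> Var 2 \<^bold>\<longrightarrow> Ex (sing_pair_in (Var 0) (Var 1) (Var 2)))
    \<^bold>\<and> All (All (Ex (Var 0 \<^bold>\<in> Var 2) \<^bold>\<and> All (Var 0 \<^bold>\<in> Var 2 \<^bold>\<longrightarrow> Var 0 \<^bold>\<in> Var 5)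
        \<^bold>\<and> All (Var 0 \<^bold>\<in> Var 1 \<^bold>\<longleftrightarrow> Ex (Var 0 \<^bold>\<in> Var 3 \<^bold>\<and> sing_pair_in (Var 0) (Var 1) (Var 4)))
        \<^bold>\<longrightarrow> Ex (Ex (Var 1 \<^bold>\<in> Var 3 \<^bold>\<and> Var 0 \<^bold>\<in> Var 2 \<^bold>\<and> sing_pair_in (Var 3) (Var 1) (Var 9)
          \<^bold>\<and> sing_pair_in (Var 2) (Var 0) (Var 10) \<^bold>\<and> sing_pair_in (Var 1) (Var 0) (Var 4))))))"

lemma stratified_by_Choice_iso:
  assumes "e 0 = 2" "e 1 = 1" "e 2 = 2" "e 5 = 3" "e 6 = 2"
  shows "stratified_by e Choice_iso"
  using assms by (simp add: Choice_iso_def stratified_by_sing_pair_in eval_nat_numeral)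

section \<open>Choice functions and strongly cantorian sets\<close>

locale nfu_model =
  fixes M :: "'a model"
  assumes universe: "universe M = UNIV" and NFU: "models M NFU"
begin

abbreviation mem' (infix "\<epsilon>" 50) where "x \<epsilon> y \<equiv> mem M x y"
abbreviation "set' \<equiv> isset M"
abbreviation "pair \<equiv> opair M"

lemma NFU_axiom: "A \<in> NFU \<Longrightarrow> sat M v A"
  using models_axiom[OF NFU] by (simp add: universe)

lemma sethood: "y \<epsilon> x \<Longrightarrow> set' x"
  using NFU_axiom[OF Sethood_in_NFU, of "\<lambda>_. x"] by (simp add: Sethood_def universe) blast

lemma extensionality:
  assumes "set' x" "set' y" "\<And>z. z \<epsilon> x \<longleftrightarrow> z \<epsilon> y"
  shows "x = y"
proof -
  have "\<forall>y x. set' x \<and> set' y \<and> (\<forall>z. z \<epsilon> x \<longleftrightarrow> z \<epsilon> y) \<longrightarrow> x = y"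
    using NFU_axiom[OF Extensionality_in_NFU, of "\<lambda>_. x"]
    by (simp add: Extensionality_def universe del: all_simps ex_simps)
  then show ?thesis using assms by blast
qed

lemma pair_inject [simp]: "pair a b = pair c d \<longleftrightarrow> a = c \<and> b = d"
proof -
  have "sat M v Pairing \<longleftrightarrow> (\<forall>d c b a. pair a b = pair c d \<longrightarrow> a = c \<and> b = d)" for v
    by (simp add: Pairing_def universe)
  then show ?thesis using NFU_axiom[OF Pairing_in_NFU] by blast
qed

lemma comprehension:
  "stratified_by e A \<Longrightarrow> \<exists>x. set' x \<and> (\<forall>y. y \<epsilon> x \<longleftrightarrow> sat M (case_nat y v) A)"
  using models_comprehension[OF NFU, of e A v] by (simp add: universe)

definition sg :: "'a \<Rightarrow> 'a"
  where "sg y = (SOME x. set' x \<and> (\<forall>z. z \<epsilon> x \<longleftrightarrow> z = y))"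

lemma sg: "set' (sg y)" "z \<epsilon> sg y \<longleftrightarrow> z = y"
proof -
  have "stratified_by (\<lambda>_. 0) (Var 0 \<^bold>= Var 1)" by simp
  from comprehension[OF this, of "\<lambda>_. y"]
  have "\<exists>x. set' x \<and> (\<forall>z. z \<epsilon> x \<longleftrightarrow> z = y)" by simp
  then have "set' (sg y) \<and> (\<forall>z. z \<epsilon> sg y \<longleftrightarrow> z = y)"
    unfolding sg_def by (rule someI_ex)
  then show "set' (sg y)" "z \<epsilon> sg y \<longleftrightarrow> z = y" by auto
qed

lemma sg_inject [simp]: "sg y = sg z \<longleftrightarrow> y = z"
  by (metis sg(2))

lemma sat_is_singleton [simp]:
  "sat M v (is_singleton a b) \<longleftrightarrow> tval M v a = sg (tval M v b)"
proof
  show "tval M v a = sg (tval M v b)" if "sat M v (is_singleton a b)"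
    using that by (intro extensionality) (auto simp: is_singleton_def universe sg)
qed (auto simp: is_singleton_def universe sg)

abbreviation app :: "'a \<Rightarrow> 'a \<Rightarrow> 'a \<Rightarrow> bool"
  where "app f y z \<equiv> pair y (sg z) \<epsilon> f"

lemma sat_sing_pair_in [simp]:
  "sat M v (sing_pair_in y z f) \<longleftrightarrow> app (tval M v f) (tval M v y) (tval M v z)"
  by (simp add: sing_pair_in_def universe)

definition iota :: "'a \<Rightarrow> 'a \<Rightarrow> bool"
  where "iota f x \<longleftrightarrow> set' f \<and> (\<forall>p. p \<epsilon> f \<longleftrightarrow> (\<exists>y. y \<epsilon> x \<and> p = pair y (sg y)))"

lemma sat_strongly_cantorian:
  "sat M v (strongly_cantorian x) \<longleftrightarrow> set' (tval M v x) \<and> (\<exists>f. iota f (tval M v x))"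
  by (simp add: strongly_cantorian_def is_iota_restr_def iota_def universe)

lemma iota_app: "iota f x \<Longrightarrow> app f y z \<longleftrightarrow> y \<epsilon> x \<and> y = z"
  by (auto simp: iota_def)

text \<open>
  A choice function relates a set to the singleton of the chosen element, because
  the components of a type-level pair must have the same type.
\<close>
definition choice_function :: "'a \<Rightarrow> bool"
  where "choice_function c \<longleftrightarrow> (\<forall>s. (\<exists>z. z \<epsilon> s) \<longrightarrow> (\<exists>!z. z \<epsilon> s \<and> app c s z))"

lemma choice_set_ex:
  assumes "models M {Choice}" and "set' F" "\<And>P. P \<epsilon> F \<Longrightarrow> \<exists>p. p \<epsilon> P"
    and "\<And>P Q p. \<lbrakk>P \<epsilon> F; Q \<epsilon> F; p \<epsilon> P; p \<epsilon> Q\<rbrakk> \<Longrightarrow> P = Q"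
  shows "\<exists>c. \<forall>P. P \<epsilon> F \<longrightarrow> (\<exists>p. \<forall>q. q \<epsilon> P \<and> q \<epsilon> c \<longleftrightarrow> q = p)"
proof -
  have "sat M v Choice \<longleftrightarrow> (\<forall>F. set' F \<and> (\<forall>P. P \<epsilon> F \<longrightarrow> (\<exists>p. p \<epsilon> P)) \<and>
      (\<forall>P Q. Q \<epsilon> F \<and> P \<epsilon> F \<and> (\<exists>p. p \<epsilon> Q \<and> p \<epsilon> P) \<longrightarrow> Q = P)
      \<longrightarrow> (\<exists>c. set' c \<and> (\<forall>P. P \<epsilon> F \<longrightarrow> (\<exists>p. \<forall>q. q \<epsilon> P \<and> q \<epsilon> c \<longleftrightarrow> q = p))))" for v
    by (simp add: Choice_def universe numeral_2_eq_2 numeral_3_eq_3)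
  moreover have "sat M v Choice" for v
    using models_axiom[OF assms(1), of Choice v] by (simp add: universe)
  ultimately have "set' F \<and> (\<forall>P. P \<epsilon> F \<longrightarrow> (\<exists>p. p \<epsilon> P)) \<and>
      (\<forall>P Q. Q \<epsilon> F \<and> P \<epsilon> F \<and> (\<exists>p. p \<epsilon> Q \<and> p \<epsilon> P) \<longrightarrow> Q = P)
      \<longrightarrow> (\<exists>c. set' c \<and> (\<forall>P. P \<epsilon> F \<longrightarrow> (\<exists>p. \<forall>q. q \<epsilon> P \<and> q \<epsilon> c \<longleftrightarrow> q = p)))"
    by simp
  moreover have "\<forall>P Q. Q \<epsilon> F \<and> P \<epsilon> F \<and> (\<exists>p. p \<epsilon> Q \<and> p \<epsilon> P) \<longrightarrow> Q = P"
    using assms(4) by blast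
  ultimately show ?thesis using assms(2,3) by blast
qed

text \<open>
  \<open>P\<close> is the set of all \<open>\<langle>s,{z}\<rangle>\<close> with \<open>z \<in> s\<close>.  These copies are disjoint for different \<open>s\<close>, so Choice
  applies to the family of them, and a choice set of that family is a choice function.
\<close>
definition is_tagged_copy :: "'a \<Rightarrow> 'a \<Rightarrow> bool"
  where "is_tagged_copy P s \<longleftrightarrow> set' P \<and> (\<forall>p. p \<epsilon> P \<longleftrightarrow> (\<exists>z. z \<epsilon> s \<and> p = pair s (sg z)))"

lemma tagged_copy_ex: "\<exists>P. is_tagged_copy P s"
proof -
  let ?A = "Ex (Var 0 \<^bold>\<in> Var 2 \<^bold>\<and>
    Ex (is_singleton (Var 0) (Var 1) \<^bold>\<and> Var 2 \<^bold>= OPair (Var 3) (Var 0)))"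
  have "stratified_by (\<lambda>_. 1) ?A"
    by (simp add: stratified_by_is_singleton)
  moreover have "sat M (case_nat p (\<lambda>_. s)) ?A \<longleftrightarrow> (\<exists>z. z \<epsilon> s \<and> p = pair s (sg z))" for p
    by (simp add: universe)
  ultimately show ?thesis
    using comprehension[of "\<lambda>_. 1" ?A "\<lambda>_. s"] unfolding is_tagged_copy_def by simp
qed

lemma choice_family_ex:
  "\<exists>F. set' F \<and> (\<forall>P. P \<epsilon> F \<longleftrightarrow> (\<exists>s. (\<exists>z. z \<epsilon> s) \<and> is_tagged_copy P s))"
proof -
  let ?A = "Ex (Ex (Var 0 \<^bold>\<in> Var 1) \<^bold>\<and> IsSet (Var 1) \<^bold>\<and>
    All (Var 0 \<^bold>\<in> Var 2 \<^bold>\<longleftrightarrow> Ex (Var 0 \<^bold>\<in> Var 2 \<^bold>\<and>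
      Ex (is_singleton (Var 0) (Var 1) \<^bold>\<and> Var 2 \<^bold>= OPair (Var 3) (Var 0)))))"
  have "stratified_by (\<lambda>_. 2) ?A"
    by (simp add: stratified_by_is_singleton)
  moreover have "sat M (case_nat P v) ?A \<longleftrightarrow> (\<exists>s. (\<exists>z. z \<epsilon> s) \<and> is_tagged_copy P s)" for P v
    by (simp add: universe is_tagged_copy_def)
  ultimately show ?thesis
    using comprehension[of "\<lambda>_. 2" ?A] by simp
qed

lemma choice_function_ex:
  assumes "models M {Choice}"
  shows "\<exists>c. choice_function c"
proof -
  obtain F where F: "set' F" "\<And>P. P \<epsilon> F \<longleftrightarrow> (\<exists>s. (\<exists>z. z \<epsilon> s) \<and> is_tagged_copy P s)"
    using choice_family_ex by blast
  have disjoint: "P = Q" if PQ: "P \<epsilon> F" "Q \<epsilon> F" "p \<epsilon> P" "p \<epsilon> Q" for P Q p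
  proof -
    obtain s t where P: "is_tagged_copy P s" and Q: "is_tagged_copy Q t"
      using PQ(1,2) F(2) by blast
    then obtain y z where "p = pair s (sg y)" "p = pair t (sg z)"
      using PQ(3,4) unfolding is_tagged_copy_def by blast
    then have "s = t" by simp
    then show "P = Q"
      using P Q unfolding is_tagged_copy_def by (intro extensionality) simp_all
  qed
  have nonempty: "\<exists>p. p \<epsilon> P" if "P \<epsilon> F" for P
    using F(2)[of P] that unfolding is_tagged_copy_def by blast
  have "\<exists>c. \<forall>P. P \<epsilon> F \<longrightarrow> (\<exists>p. \<forall>q. q \<epsilon> P \<and> q \<epsilon> c \<longleftrightarrow> q = p)"
    by (rule choice_set_ex[OF assms F(1)]) (fact nonempty, fact disjoint)
  then obtain c where c: "\<forall>P. P \<epsilon> F \<longrightarrow> (\<exists>p. \<forall>q. q \<epsilon> P \<and> q \<epsilon> c \<longleftrightarrow> q = p)"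
    by blast
  have "\<exists>!z. z \<epsilon> s \<and> app c s z" if "\<exists>z. z \<epsilon> s" for s
  proof -
    obtain P where P: "is_tagged_copy P s" using tagged_copy_ex by blast
    then have "P \<epsilon> F" using F(2)[of P] that by blast
    then obtain p where p: "\<forall>q. q \<epsilon> P \<and> q \<epsilon> c \<longleftrightarrow> q = p" using c by blast
    have graph: "q \<epsilon> P \<longleftrightarrow> (\<exists>z. z \<epsilon> s \<and> q = pair s (sg z))" for q
      using P by (simp add: is_tagged_copy_def)
    have "p \<epsilon> P" "p \<epsilon> c" using p by blast+
    then obtain z where z: "z \<epsilon> s" "p = pair s (sg z)" using graph by blast
    show ?thesis
    proof
      show "z \<epsilon> s \<and> app c s z" using z \<open>p \<epsilon> c\<close> by simp
      show "w = z" if "w \<epsilon> s \<and> app c s w" for w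
      proof -
        have "pair s (sg w) = p" using that p graph by blast
        then show ?thesis using z(2) by simp
      qed
    qed
  qed
  then show ?thesis unfolding choice_function_def by blast
qed

text \<open>
  \<open>f\<close> is a bijection from \<open>x\<close> to the singletons of elements of \<open>x'\<close> that carries choices by \<open>c\<close> to
  choices by \<open>d\<close>.  In the last clause \<open>t = \<Union>f``s\<close>; its instances with a singleton \<open>s\<close>
  make \<open>f\<close> total on \<open>x\<close>.  Both \<open>x' = x\<close> and \<open>d = c\<close> hold in all uses; they are kept apart because
  stratification gives them different types.
\<close>
definition choice_iso :: "'a \<Rightarrow> 'a \<Rightarrow> 'a \<Rightarrow> 'a \<Rightarrow> 'a \<Rightarrow> bool"
  where "choice_iso f x x' c d \<longleftrightarrow>
    (\<forall>y z. app f y z \<longrightarrow> y \<epsilon> x \<and> z \<epsilon> x')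
    \<and> (\<forall>y z w. app f y z \<and> app f y w \<longrightarrow> z = w)
    \<and> (\<forall>y w z. app f y z \<and> app f w z \<longrightarrow> y = w)
    \<and> (\<forall>z. z \<epsilon> x' \<longrightarrow> (\<exists>y. app f y z))
    \<and> (\<forall>s t. (\<exists>y. y \<epsilon> s) \<and> (\<forall>y. y \<epsilon> s \<longrightarrow> y \<epsilon> x) \<and> (\<forall>z. z \<epsilon> t \<longleftrightarrow> (\<exists>y. y \<epsilon> s \<and> app f y z))
        \<longrightarrow> (\<exists>y z. y \<epsilon> s \<and> z \<epsilon> t \<and> app c s y \<and> app d t z \<and> app f y z))"

lemma choice_iso_iota:
  assumes "iota g x" and c: "choice_function c"
  shows "choice_iso g x x c c"
proof -
  have "\<exists>y z. y \<epsilon> s \<and> z \<epsilon> t \<and> app c s y \<and> app c t z \<and> app g y z"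
    if s: "y \<epsilon> s" "\<forall>y. y \<epsilon> s \<longrightarrow> y \<epsilon> x" and t: "\<forall>z. z \<epsilon> t \<longleftrightarrow> (\<exists>y. y \<epsilon> s \<and> app g y z)" for s t y
  proof -
    have eq: "z \<epsilon> t \<longleftrightarrow> z \<epsilon> s" for z using s t iota_app[OF assms(1)] by auto
    have "t = s" using s(1) eq by (auto intro!: extensionality sethood)
    moreover obtain z where "z \<epsilon> s" "app c s z" using c s(1) unfolding choice_function_def by blast
    ultimately show ?thesis using s(2) iota_app[OF assms(1)] by blast
  qed
  then show ?thesis unfolding choice_iso_def using iota_app[OF assms(1)] by auto
qed

text \<open>
  The elements \<open>y\<close> with \<open>f(y) \<noteq> {y}\<close> form a set \<open>B\<close>, comprehended with \<open>\<iota>\<restriction>x\<close> as a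
  parameter, and \<open>f\<close> maps \<open>B\<close> onto its own singletons.  So \<open>f\<close> would fix the element chosen from \<open>B\<close>.
\<close>
lemma choice_iso_unique:
  assumes g: "iota g x" and c: "choice_function c" and f: "choice_iso f x x c c"
  shows "app f y z \<longleftrightarrow> y \<epsilon> x \<and> y = z"
proof -
  have f_dom: "y \<epsilon> x" "z \<epsilon> x" if "app f y z" for y z
    using f that unfolding choice_iso_def by blast+
  have f_fun: "z = w" if "app f y z" "app f y w" for y z w
    using f that unfolding choice_iso_def by blast
  have f_inj: "y = w" if "app f y z" "app f w z" for y z w
    using f that unfolding choice_iso_def by blast
  have f_onto: "\<exists>y. app f y z" if "z \<epsilon> x" for z
    using f that unfolding choice_iso_def by blast
  have f_choice: "\<exists>y z. y \<epsilon> s \<and> z \<epsilon> t \<and> app c s y \<and> app c t z \<and> app f y z"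
    if "\<exists>y. y \<epsilon> s" "\<forall>y. y \<epsilon> s \<longrightarrow> y \<epsilon> x" "\<forall>z. z \<epsilon> t \<longleftrightarrow> (\<exists>y. y \<epsilon> s \<and> app f y z)" for s t
    using f that unfolding choice_iso_def by blast
  let ?A = "Var 0 \<^bold>\<in> Var 1 \<^bold>\<and> Ex (OPair (Var 1) (Var 0) \<^bold>\<in> Var 3 \<^bold>\<and> \<^bold>\<not> OPair (Var 1) (Var 0) \<^bold>\<in> Var 4)"
  have "stratified_by (case_nat 0 (\<lambda>_. 1)) ?A" by simp
  from comprehension[OF this, of "case_nat x (case_nat g (\<lambda>_. f))"]
  obtain B where B: "\<And>y. y \<epsilon> B \<longleftrightarrow> y \<epsilon> x \<and> \<not> app f y y"
    using g by (auto simp: universe iota_def)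
  have "\<not> (\<exists>y. y \<epsilon> B)"
  proof
    assume ne: "\<exists>y. y \<epsilon> B"
    have "z \<epsilon> B \<longleftrightarrow> (\<exists>y. y \<epsilon> B \<and> app f y z)" for z
      using B f_dom f_fun f_inj f_onto by metis
    then obtain y z where "y \<epsilon> B" "z \<epsilon> B" "app c B y" "app c B z" "app f y z"
      using f_choice[of B B] ne B by blast
    moreover from this have "y = z" using c ne unfolding choice_function_def by blast
    ultimately show False using B by blast
  qed
  then show ?thesis using B f_dom f_fun by blast
qed

lemma sat_Choice_iso:
  "sat M v Choice_iso \<longleftrightarrow> choice_iso (v 0) (v 2) (v 1) (v 5) (v 6)"
  by (simp add: Choice_iso_def choice_iso_def universe eval_nat_numeral)

text \<open>
  The defining condition of the set \<open>j\<close> is stratified with \<open>z\<close> at type 0, with \<open>y\<close>, \<open>t\<close>, \<open>x'\<close> and the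
  elements of \<open>j\<close> at type 1, and with \<open>f\<close>, \<open>s\<close> and \<open>x\<close> at type 2; then \<open>c\<close> is needed both at type 3,
  for choosing from \<open>s\<close>, and at type 2, for choosing from \<open>t\<close>.
\<close>
lemma iota_union_ex:
  assumes e: "iota e X" and X: "\<And>x. x \<epsilon> X \<Longrightarrow> \<exists>g. iota g x"
    and u: "\<And>y. y \<epsilon> u \<longleftrightarrow> (\<exists>x. x \<epsilon> X \<and> y \<epsilon> x)" and c: "choice_function c"
  shows "\<exists>j. iota j u"
proof -
  let ?B = "Ex (Ex (Ex (is_singleton (Var 0) (Var 1) \<^bold>\<and> Var 6 \<^bold>= OPair (Var 2) (Var 0) \<^bold>\<and> Var 6 \<^bold>\<in> Var 3)))"
  let ?A = "Ex (Ex (Ex (sing_pair_in (Var 2) (Var 1) (Var 4) \<^bold>\<and> Choice_iso \<^bold>\<and> ?B)))"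
  let ?e = "case_nat 1 (case_nat 3 (case_nat 3 (\<lambda>_. 2)))"
  let ?v = "case_nat e (\<lambda>_. c)"
  have "stratified_by (case_nat 2 (case_nat 1 (case_nat 2 ?e))) Choice_iso"
    by (rule stratified_by_Choice_iso) (simp_all add: eval_nat_numeral)
  moreover have "stratified_by (case_nat 2 (case_nat 1 (case_nat 2 ?e))) ?B"
    by (simp add: stratified_by_is_singleton eval_nat_numeral)
  moreover have "stratified_by (case_nat 2 (case_nat 1 (case_nat 2 ?e))) (sing_pair_in (Var 2) (Var 1) (Var 4))"
    by (simp add: stratified_by_sing_pair_in eval_nat_numeral)
  ultimately have "stratified_by ?e ?A"
    unfolding stratified_by_connectives by blast
  then obtain j where "set' j" and "\<forall>p. p \<epsilon> j \<longleftrightarrow> sat M (case_nat p ?v) ?A"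
    using comprehension by blast
  moreover have "sat M (case_nat p ?v) ?A \<longleftrightarrow> (\<exists>x x' f. app e x x' \<and> choice_iso f x x' c c
      \<and> (\<exists>y z. p = pair y (sg z) \<and> p \<epsilon> f))" for p
    by (simp add: sat_Choice_iso universe eval_nat_numeral)
  ultimately have j: "p \<epsilon> j \<longleftrightarrow> (\<exists>x x' f. app e x x' \<and> choice_iso f x x' c c
      \<and> (\<exists>y z. p = pair y (sg z) \<and> p \<epsilon> f))" for p
    by blast
  have "p \<epsilon> j \<longleftrightarrow> (\<exists>y. y \<epsilon> u \<and> p = pair y (sg y))" for p
  proof
    assume "p \<epsilon> j"
    then obtain x x' f y z where *: "app e x x'" "choice_iso f x x' c c" "p = pair y (sg z)" "p \<epsilon> f"
      unfolding j by blast
    then have x: "x' = x" "x \<epsilon> X" using iota_app[OF e, of x x'] by blast+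
    obtain g where "iota g x" using X[OF x(2)] by blast
    moreover have "app f y z" "choice_iso f x x c c" using * x(1) by simp_all
    ultimately have "y \<epsilon> x" "y = z" using choice_iso_unique[OF _ c, of g x f y z] by blast+
    moreover have "y \<epsilon> u" using u[of y] \<open>y \<epsilon> x\<close> x(2) by blast
    ultimately show "\<exists>y. y \<epsilon> u \<and> p = pair y (sg y)" using *(3) by blast
  next
    assume "\<exists>y. y \<epsilon> u \<and> p = pair y (sg y)"
    then obtain y where y: "y \<epsilon> u" "p = pair y (sg y)" by blast
    then obtain x where x: "x \<epsilon> X" "y \<epsilon> x" using u[of y] by blast
    obtain g where g: "iota g x" using X[OF x(1)] by blast
    have "app e x x" using iota_app[OF e] x(1) by simp
    moreover have "choice_iso g x x c c" using g c by (rule choice_iso_iota)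
    moreover have "p \<epsilon> g" using iota_app[OF g] x(2) y(2) by simp
    ultimately show "p \<epsilon> j" unfolding j using y(2) by blast
  qed
  with \<open>set' j\<close> have "iota j u" unfolding iota_def by simp
  then show ?thesis by blast
qed

lemma sat_is_sumset:
  "sat M v (is_sumset u x) \<longleftrightarrow> set' (tval M v u)
    \<and> (\<forall>y. y \<epsilon> tval M v u \<longleftrightarrow> (\<exists>z. z \<epsilon> tval M v x \<and> y \<epsilon> z))"
  by (simp add: is_sumset_def universe)

lemma sat_SCU:
  "sat M v SCU \<longleftrightarrow> (\<forall>X. set' X \<and> (\<exists>e. iota e X) \<and> (\<forall>x. x \<epsilon> X \<longrightarrow> set' x \<and> (\<exists>g. iota g x))
    \<longrightarrow> (\<exists>u. set' u \<and> (\<forall>y. y \<epsilon> u \<longleftrightarrow> (\<exists>z. z \<epsilon> X \<and> y \<epsilon> z)) \<and> set' u \<and> (\<exists>j. iota j u)))"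
  by (simp add: SCU_def sat_strongly_cantorian sat_is_sumset universe)

lemma sumset_ex: "\<exists>u. set' u \<and> (\<forall>y. y \<epsilon> u \<longleftrightarrow> (\<exists>x. x \<epsilon> X \<and> y \<epsilon> x))"
proof -
  let ?A = "Ex (Var 0 \<^bold>\<in> Var 2 \<^bold>\<and> Var 1 \<^bold>\<in> Var 0)"
  have "stratified_by (case_nat 0 (\<lambda>_. 2)) ?A" by simp
  from comprehension[OF this, of "\<lambda>_. X"] show ?thesis
    by (simp add: universe)
qed

lemma models_SCU:
  assumes "models M {Choice}"
  shows "models M {SCU}"
proof -
  obtain c where c: "choice_function c" using choice_function_ex assms by blast
  have "sat M v SCU" for v
    unfolding sat_SCU
  proof (intro allI impI, elim conjE exE)
    fix X e
    assume e: "iota e X" and X: "\<forall>x. x \<epsilon> X \<longrightarrow> set' x \<and> (\<exists>g. iota g x)"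
    obtain u where u: "set' u" "\<forall>y. y \<epsilon> u \<longleftrightarrow> (\<exists>x. x \<epsilon> X \<and> y \<epsilon> x)"
      using sumset_ex by blast
    have "\<exists>j. iota j u"
      by (rule iota_union_ex[OF e _ _ c]) (use X u(2) in blast)+
    then show "\<exists>u. set' u \<and> (\<forall>y. y \<epsilon> u \<longleftrightarrow> (\<exists>z. z \<epsilon> X \<and> y \<epsilon> z)) \<and> set' u \<and> (\<exists>j. iota j u)"
      using u by blast
  qed
  then show ?thesis using NFU by (simp add: models_def)
qed

end

theorem theorem32: "NFU \<union> {Choice} \<turnstile> SCU"
proof (rule completeness)
  show "sentence A" if "A \<in> NFU \<union> {Choice}" for A
    using that
    by (auto simp: NFU_def sentence_def Sethood_def Extensionality_def Pairing_def Choice_def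
      Neg_def Conj_def Iff_def Ex_def)
  show "sentence SCU"
    by (simp add: SCU_def sentence_def strongly_cantorian_def is_iota_restr_def is_singleton_def
      is_sumset_def Neg_def Conj_def Iff_def Ex_def tlift_def)
  show "infinite (universe M)" if "models M (NFU \<union> {Choice})" for M :: "tm set model"
    using that by (intro models_NFU_infinite) (auto simp: models_def)
  show "models M {SCU}" if "models M (NFU \<union> {Choice})" "universe M = UNIV" for M :: "nat model"
  proof -
    interpret nfu_model M
      using that by unfold_locales (auto simp: models_def)
    show ?thesis using that by (intro models_SCU) (auto simp: models_def)
  qed
qed

end
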